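(* The class of $\infty$-digraphs is determined by the complementarity spectrum (DCS): for every $n$, if $D$ and $H$ are $\infty$-digraphs, both with $n$ vertices, and $\Pi(D)=\Pi(H)$, then $D$ and $H$ are isomorphic.
   Context: Digraphs are finite and simple (no loops, no multiple arcs; opposite arcs are allowed). The adjacency matrix $A(D)=(a_{ij})$ of a digraph $D$ has $a_{ij}=1$ if $(i,j)$ is an arc and $a_{ij}=0$ otherwise. A real number $\lambda$ is a complementarity eigenvalue of a real $n\times n$ matrix $A$ if there is a nonzero vector $x\in\mathbb{R}^n$ with $x\ge 0$ (coordinatewise), $Ax\ge\lambda x$ and $\langle x,Ax-\lambda x\rangle=0$. The complementarity spectrum $\Pi(D)$ is the set (not multiset) of complementarity eigenvalues of $A(D)$; it does not depend on the vertex labelling. For integers $r,s\ge 2$, $\infty(r,s)$ is the digraph on $n=r+s-1$ vertices obtained from the directed cycles $\vec C_r$ (vertices $1,\dots,r$, arcs $(k,k+1)$ and $(r,1)$) and $\vec C_s$ (vertices $1',\dots,s'$, arcs $(k',(k+1)')$ and $(s',1')$) by identifying $1$ with $1'$. An $\infty$-digraph is a digraph isomorphic to some $\infty(r,s)$. A class of digraphs is DCS if any two digraphs of the class having the same number of vertices and the same complementarity spectrum are isomorphic. *)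

theory Defs
  imports
    Complex_Main
    "Graph_Theory.Digraph_Isomorphism"
    "Graph_Theory.Pair_Digraph"
    "Jordan_Normal_Form.Matrix"
begin

text \<open>Intended for square matrices. The order on vectors is coordinatewise.\<close>

definition complementarity_eigenvalue :: "real mat \<Rightarrow> real \<Rightarrow> bool" where
  "complementarity_eigenvalue A l \<longleftrightarrow>
    (\<exists>x \<in> carrier_vec (dim_row A).
       x \<noteq> 0\<^sub>v (dim_row A) \<and>
       0\<^sub>v (dim_row A) \<le> x \<and>
       l \<cdot>\<^sub>v x \<le> A *\<^sub>v x \<and>
       x \<bullet> (A *\<^sub>v x - l \<cdot>\<^sub>v x) = 0)"

text \<open>The list \<open>vs\<close> enumerates the vertices; this is the labelling that turns
  \<open>D\<close> into a matrix. Rows are tails and columns are heads of arcs.\<close>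

definition adjacency_matrix :: "('a, 'b) pre_digraph \<Rightarrow> 'a list \<Rightarrow> real mat" where
  "adjacency_matrix D vs =
    mat (length vs) (length vs) (\<lambda>(i, j). if vs ! i \<rightarrow>\<^bsub>D\<^esub> vs ! j then 1 else 0)"

text \<open>The existential quantifier over labellings is harmless, see
  \<open>complementarity_spectrum_labelling\<close> below.\<close>

definition complementarity_spectrum :: "('a, 'b) pre_digraph \<Rightarrow> real set" where
  "complementarity_spectrum D =
    {l. \<exists>vs. distinct vs \<and> set vs = verts D \<and>
          complementarity_eigenvalue (adjacency_matrix D vs) l}"

lemma complementarity_eigenvalue_adjacency_matrix:
  fixes D :: "('a, 'b) pre_digraph"
  assumes d: "distinct vs" and V: "set vs = verts D"
  shows "complementarity_eigenvalue (adjacency_matrix D vs) l \<longleftrightarrow>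
    (\<exists>f. (\<exists>v\<in>verts D. f v \<noteq> 0) \<and> (\<forall>v\<in>verts D. 0 \<le> f v) \<and>
      (\<forall>v\<in>verts D. l * f v \<le> (\<Sum>w\<in>verts D. (if v \<rightarrow>\<^bsub>D\<^esub> w then 1 else 0) * f w)) \<and>
      (\<Sum>v\<in>verts D. f v * ((\<Sum>w\<in>verts D. (if v \<rightarrow>\<^bsub>D\<^esub> w then 1 else 0) * f w) - l * f v)) = 0)"
    (is "?L \<longleftrightarrow> (\<exists>f. ?P f)")
proof -
  let ?n = "length vs" and ?A = "adjacency_matrix D vs"
  let ?a = "\<lambda>v w. (if v \<rightarrow>\<^bsub>D\<^esub> w then 1 else 0) :: real"
  have bij: "bij_betw ((!) vs) {0..<?n} (verts D)"
    using d V by (simp add: bij_betw_nth atLeast0LessThan)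
  have sums: "(\<Sum>i = 0..<?n. g (vs ! i)) = (\<Sum>v\<in>verts D. g v)" for g :: "'a \<Rightarrow> real"
    by (rule sum.reindex_bij_betw[OF bij])
  have all: "(\<forall>v\<in>verts D. Q v) \<longleftrightarrow> (\<forall>i<?n. Q (vs ! i))" for Q
    using V by (metis in_set_conv_nth)
  have ex: "(\<exists>v\<in>verts D. Q v) \<longleftrightarrow> (\<exists>i<?n. Q (vs ! i))" for Q
    using V by (metis in_set_conv_nth)
  have [simp]: "dim_row ?A = ?n" "dim_col ?A = ?n"
    by (simp_all add: adjacency_matrix_def)
  have key: "x \<noteq> 0\<^sub>v ?n \<and> 0\<^sub>v ?n \<le> x \<and> l \<cdot>\<^sub>v x \<le> ?A *\<^sub>v x \<and>
      x \<bullet> (?A *\<^sub>v x - l \<cdot>\<^sub>v x) = 0 \<longleftrightarrow> ?P f"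
    if x: "x \<in> carrier_vec ?n" and xf: "\<And>i. i < ?n \<Longrightarrow> x $ i = f (vs ! i)" for x f
  proof -
    have dx: "dim_vec x = ?n" using x by simp
    have Ax: "(?A *\<^sub>v x) $ i = (\<Sum>w\<in>verts D. ?a (vs ! i) w * f w)" if "i < ?n" for i
    proof -
      have "(?A *\<^sub>v x) $ i = (\<Sum>j = 0..<?n. ?a (vs ! i) (vs ! j) * f (vs ! j))"
        using that dx xf by (simp add: scalar_prod_def adjacency_matrix_def)
      then show ?thesis using sums[of "\<lambda>w. ?a (vs ! i) w * f w"] by simp
    qed
    have 1: "x \<noteq> 0\<^sub>v ?n \<longleftrightarrow> (\<exists>v\<in>verts D. f v \<noteq> 0)"
      unfolding ex using dx xf by (auto simp: vec_eq_iff)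
    have 2: "0\<^sub>v ?n \<le> x \<longleftrightarrow> (\<forall>v\<in>verts D. 0 \<le> f v)"
      unfolding all using dx xf by (auto simp: less_eq_vec_def)
    have 3: "l \<cdot>\<^sub>v x \<le> ?A *\<^sub>v x \<longleftrightarrow>
        (\<forall>v\<in>verts D. l * f v \<le> (\<Sum>w\<in>verts D. ?a v w * f w))"
      unfolding all using dx xf Ax
      by (simp add: less_eq_vec_def del: index_mult_mat_vec)
    have "x \<bullet> (?A *\<^sub>v x - l \<cdot>\<^sub>v x) =
        (\<Sum>i = 0..<?n. f (vs ! i) * ((\<Sum>w\<in>verts D. ?a (vs ! i) w * f w) - l * f (vs ! i)))"
      unfolding scalar_prod_def using dx xf Ax
      by (intro sum.cong) (simp_all del: index_mult_mat_vec)
    then have 4: "x \<bullet> (?A *\<^sub>v x - l \<cdot>\<^sub>v x) =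
        (\<Sum>v\<in>verts D. f v * ((\<Sum>w\<in>verts D. ?a v w * f w) - l * f v))"
      using sums[of "\<lambda>v. f v * ((\<Sum>w\<in>verts D. ?a v w * f w) - l * f v)"] by simp
    show ?thesis unfolding 1 2 3 4 ..
  qed
  show ?thesis
  proof
    assume ?L
    then obtain x where x: "x \<in> carrier_vec ?n"
      and px: "x \<noteq> 0\<^sub>v ?n \<and> 0\<^sub>v ?n \<le> x \<and> l \<cdot>\<^sub>v x \<le> ?A *\<^sub>v x \<and>
        x \<bullet> (?A *\<^sub>v x - l \<cdot>\<^sub>v x) = 0"
      unfolding complementarity_eigenvalue_def by auto
    define f where "f v = x $ (the_inv_into {0..<?n} ((!) vs) v)" for v
    have "x $ i = f (vs ! i)" if "i < ?n" for i
      unfolding f_def using the_inv_into_f_f[OF bij_betw_imp_inj_on[OF bij]] that by simp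
    from key[OF x this] px show "\<exists>f. ?P f" by blast
  next
    assume "\<exists>f. ?P f"
    then obtain f where f: "?P f" by blast
    have c: "vec ?n (\<lambda>i. f (vs ! i)) \<in> carrier_vec ?n" by simp
    have "vec ?n (\<lambda>i. f (vs ! i)) $ i = f (vs ! i)" if "i < ?n" for i
      using that by simp
    from iffD2[OF key[OF c this] f] show ?L
      unfolding complementarity_eigenvalue_def \<open>dim_row ?A = ?n\<close> by (rule bexI[OF _ c])
  qed
qed

lemma complementarity_spectrum_labelling:
  assumes "distinct vs" "set vs = verts D"
  shows "complementarity_spectrum D = {l. complementarity_eigenvalue (adjacency_matrix D vs) l}"
proof -
  have "complementarity_eigenvalue (adjacency_matrix D us) l \<longleftrightarrow>
      complementarity_eigenvalue (adjacency_matrix D vs) l"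
    if "distinct us" "set us = verts D" for us l
    by (rule trans[OF complementarity_eigenvalue_adjacency_matrix[OF that]
          complementarity_eigenvalue_adjacency_matrix[OF assms, symmetric]])
  then show ?thesis
    using assms unfolding complementarity_spectrum_def by blast
qed

definition dicycle :: "nat \<Rightarrow> nat pair_pre_digraph" where
  "dicycle r = \<lparr>pverts = {1..r}, parcs = {(k, k + 1) | k. 1 \<le> k \<and> k < r} \<union> {(r, 1)}\<rparr>"

text \<open>The vertex \<open>k'\<close> of the second cycle becomes \<open>1\<close> if \<open>k = 1\<close>, and otherwise
  the new vertex \<open>r + k - 1\<close>, so that the vertex set is \<open>{1..r + s - 1}\<close>.\<close>

definition glue :: "nat \<Rightarrow> nat \<Rightarrow> nat" where
  "glue r k = (if k = 1 then 1 else r + k - 1)"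

definition infinity_graph :: "nat \<Rightarrow> nat \<Rightarrow> nat pair_pre_digraph" where
  "infinity_graph r s =
    \<lparr>pverts = pverts (dicycle r) \<union> glue r ` pverts (dicycle s),
     parcs = parcs (dicycle r) \<union> map_prod (glue r) (glue r) ` parcs (dicycle s)\<rparr>"

lemma pverts_infinity_graph:
  assumes "2 \<le> r" "2 \<le> s"
  shows "pverts (infinity_graph r s) = {1..r + s - 1}"
proof -
  have "x \<in> glue r ` {1..s}" if "r < x" "x \<le> r + s - 1" for x
    using that assms by (intro image_eqI[of _ _ "x + 1 - r"]) (auto simp: glue_def)
  moreover have "glue r k \<in> {1..r + s - 1}" if "k \<in> {1..s}" for k
    using that assms by (auto simp: glue_def)
  moreover have "{1..r} \<subseteq> {1..r + s - 1}"
    using assms by auto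
  ultimately have "{1..r} \<union> glue r ` {1..s} = {1..r + s - 1}"
    by (intro equalityI subsetI) (blast, metis UnCI atLeastAtMost_iff not_le)
  then show ?thesis
    by (simp add: infinity_graph_def dicycle_def)
qed

lemma digraph_infinity_graph:
  assumes "2 \<le> r" "2 \<le> s"
  shows "digraph (with_proj (infinity_graph r s))"
proof -
  have fin: "finite (parcs (dicycle m))" for m
    by (rule finite_subset[of _ "{0..m} \<times> {0..m} \<union> {(m, 1)}"]) (auto simp: dicycle_def)
  have "pair_digraph (infinity_graph r s)"
  proof
    fix e assume e: "e \<in> parcs (infinity_graph r s)"
    show "fst e \<in> pverts (infinity_graph r s)" "snd e \<in> pverts (infinity_graph r s)"
      using e assms unfolding pverts_infinity_graph[OF assms]
      by (auto simp: infinity_graph_def dicycle_def glue_def)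
    show "fst e \<noteq> snd e"
      using e assms by (auto simp: infinity_graph_def dicycle_def glue_def split: if_splits)
  next
    show "finite (pverts (infinity_graph r s))"
      by (simp add: pverts_infinity_graph[OF assms])
    show "finite (parcs (infinity_graph r s))"
      using fin by (simp add: infinity_graph_def)
  qed
  then interpret pair_digraph "infinity_graph r s" .
  show ?thesis by unfold_locales
qed

definition infinity_digraphs :: "('a, 'b) pre_digraph set" where
  "infinity_digraphs =
    {D. digraph D \<and> (\<exists>r s. 2 \<le> r \<and> 2 \<le> s \<and> digraph_iso D (with_proj (infinity_graph r s)))}"

text \<open>\<open>DCS\<close> abbreviates ``determined by the complementarity spectrum''.\<close>

definition DCS :: "('a, 'b) pre_digraph set \<Rightarrow> bool" where
  "DCS \<C> \<longleftrightarrow>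
    (\<forall>n. \<forall>D \<in> \<C>. \<forall>H \<in> \<C>.
      card (verts D) = n \<and> card (verts H) = n \<and>
      complementarity_spectrum D = complementarity_spectrum H \<longrightarrow> digraph_iso D H)"

end

theory Submission
  imports Defs
begin

text \<open>
  The part of the complementarity spectrum above \<open>1\<close> already determines an \<open>\<infinity>\<close>-digraph of given
  order. Let \<open>x\<close> be a complementarity eigenvector of \<open>\<infinity>(r,s)\<close> for \<open>l > 1\<close>. Every vertex other than
  the centre has exactly one out-neighbour, so along either cycle each entry is at least \<open>l\<close> times
  the preceding one, with equality wherever the preceding one is positive. Hence the centre has a
  positive entry, say \<open>1\<close>, and its successor on the cycle of length \<open>r\<close> has the entry \<open>0\<close> or
  \<open>l\<^sup>-\<^sup>(\<^sup>r\<^sup>-\<^sup>1\<^sup>)\<close>; likewise for \<open>s\<close>. The entries of the two successors add up to \<open>l\<close>. If one of them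
  were \<open>0\<close>, then \<open>l \<le> 1\<close> would follow; so both are positive, and
  \<open>l\<^sup>-\<^sup>r + l\<^sup>-\<^sup>s = 1\<close>. Conversely each \<open>l > 1\<close> with this property is an eigenvalue with a positive
  eigenvector (\<open>complementarity_spectrum_infinity_graph\<close>), and such an \<open>l\<close> exists by the
  intermediate value theorem.

  If \<open>\<infinity>(r,s)\<close> and \<open>\<infinity>(r',s')\<close> share such an \<open>l\<close> and have the same order, then
  \<open>{l\<^sup>-\<^sup>r, l\<^sup>-\<^sup>s}\<close> and \<open>{l\<^sup>-\<^sup>r\<^sup>', l\<^sup>-\<^sup>s\<^sup>'}\<close> have the same sum \<open>1\<close> and, because
  \<open>r + s = r' + s'\<close>, the same product. So they are the roots of the same quadratic, and
  \<open>{r, s} = {r', s'}\<close> (\<open>exponents_determined\<close>). It remains to note that the two cycles can be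
  exchanged.
\<close>

section \<open>Complementarity eigenvectors as functions on the vertices\<close>

text \<open>A sum of nonnegative terms vanishes only if each term does, which turns the orthogonality
  condition into complementary slackness at every vertex.\<close>

lemma complementarity_spectrum_iff:
  assumes "fin_digraph D"
  shows "l \<in> complementarity_spectrum D \<longleftrightarrow>
    (\<exists>x. (\<exists>v\<in>verts D. x v \<noteq> 0) \<and>
      (\<forall>v\<in>verts D. 0 \<le> x v \<and> l * x v \<le> (\<Sum>w | v \<rightarrow>\<^bsub>D\<^esub> w. x w) \<and>
        (0 < x v \<longrightarrow> (\<Sum>w | v \<rightarrow>\<^bsub>D\<^esub> w. x w) = l * x v)))"
proof -
  interpret fin_digraph D by fact
  obtain vs where vs: "distinct vs" "set vs = verts D"
    using finite_distinct_list[OF finite_verts] by blast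
  have S: "(\<Sum>w\<in>verts D. (if v \<rightarrow>\<^bsub>D\<^esub> w then 1 else 0) * x w) = (\<Sum>w | v \<rightarrow>\<^bsub>D\<^esub> w. x w)"
    for v and x :: "'a \<Rightarrow> real"
  proof (rule sum.mono_neutral_cong_right)
    show "{w. v \<rightarrow>\<^bsub>D\<^esub> w} \<subseteq> verts D" by (auto dest: adj_in_verts(2))
  qed simp_all
  have slack: "((\<Sum>v\<in>verts D. x v * (S v - l * x v)) = 0) \<longleftrightarrow>
      (\<forall>v\<in>verts D. 0 < x v \<longrightarrow> S v = l * x v)"
    if "\<forall>v\<in>verts D. 0 \<le> x v" "\<forall>v\<in>verts D. l * x v \<le> S v" for x S :: "'a \<Rightarrow> real"
  proof -
    have "(\<Sum>v\<in>verts D. x v * (S v - l * x v)) = 0 \<longleftrightarrow>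
        (\<forall>v\<in>verts D. x v * (S v - l * x v) = 0)"
      using that by (intro sum_nonneg_eq_0_iff) simp_all
    also have "\<dots> \<longleftrightarrow> (\<forall>v\<in>verts D. 0 < x v \<longrightarrow> S v = l * x v)"
      using that(1) by (intro ball_cong refl) force
    finally show ?thesis .
  qed
  have "l \<in> complementarity_spectrum D \<longleftrightarrow>
      (\<exists>x. (\<exists>v\<in>verts D. x v \<noteq> 0) \<and> (\<forall>v\<in>verts D. 0 \<le> x v) \<and>
        (\<forall>v\<in>verts D. l * x v \<le> (\<Sum>w | v \<rightarrow>\<^bsub>D\<^esub> w. x w)) \<and>
        (\<Sum>v\<in>verts D. x v * ((\<Sum>w | v \<rightarrow>\<^bsub>D\<^esub> w. x w) - l * x v)) = 0)"
    unfolding complementarity_spectrum_labelling[OF vs]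
    by (simp add: complementarity_eigenvalue_adjacency_matrix[OF vs] S)
  also have "\<dots> \<longleftrightarrow> (\<exists>x. (\<exists>v\<in>verts D. x v \<noteq> 0) \<and>
      (\<forall>v\<in>verts D. 0 \<le> x v \<and> l * x v \<le> (\<Sum>w | v \<rightarrow>\<^bsub>D\<^esub> w. x w) \<and>
        (0 < x v \<longrightarrow> (\<Sum>w | v \<rightarrow>\<^bsub>D\<^esub> w. x w) = l * x v)))"
  proof (rule ex_cong1)
    fix x
    show "((\<exists>v\<in>verts D. x v \<noteq> 0) \<and> (\<forall>v\<in>verts D. 0 \<le> x v) \<and>
        (\<forall>v\<in>verts D. l * x v \<le> (\<Sum>w | v \<rightarrow>\<^bsub>D\<^esub> w. x w)) \<and>
        (\<Sum>v\<in>verts D. x v * ((\<Sum>w | v \<rightarrow>\<^bsub>D\<^esub> w. x w) - l * x v)) = 0) \<longleftrightarrow>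
      ((\<exists>v\<in>verts D. x v \<noteq> 0) \<and>
      (\<forall>v\<in>verts D. 0 \<le> x v \<and> l * x v \<le> (\<Sum>w | v \<rightarrow>\<^bsub>D\<^esub> w. x w) \<and>
        (0 < x v \<longrightarrow> (\<Sum>w | v \<rightarrow>\<^bsub>D\<^esub> w. x w) = l * x v)))"
      using slack[of x "\<lambda>v. \<Sum>w | v \<rightarrow>\<^bsub>D\<^esub> w. x w"] by (simp only: ball_conj_distrib) argo
  qed
  finally show ?thesis .
qed

lemma complementarity_spectrum_app_iso_subset:
  assumes "fin_digraph G" and f: "pre_digraph.digraph_isomorphism G f"
  shows "complementarity_spectrum G \<subseteq> complementarity_spectrum (app_iso f G)"
proof
  interpret fin_digraph G by fact
  interpret H: fin_digraph "app_iso f G" using f by (rule fin_digraphI_app_iso)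
  let ?f = "iso_verts f"
  have inj: "inj_on ?f (verts G)" using f by (rule digraph_isomorphism_inj_on_verts)
  fix l assume "l \<in> complementarity_spectrum G"
  then obtain x where nz: "\<exists>v\<in>verts G. x v \<noteq> 0"
    and x: "\<And>v. v \<in> verts G \<Longrightarrow> 0 \<le> x v \<and> l * x v \<le> (\<Sum>w | v \<rightarrow>\<^bsub>G\<^esub> w. x w) \<and>
        (0 < x v \<longrightarrow> (\<Sum>w | v \<rightarrow>\<^bsub>G\<^esub> w. x w) = l * x v)"
    unfolding complementarity_spectrum_iff[OF \<open>fin_digraph G\<close>] by blast
  define y where "y u = x (the_inv_into (verts G) ?f u)" for u
  have y: "y (?f v) = x v" if "v \<in> verts G" for v
    using that inj by (simp add: y_def the_inv_into_f_f)
  have S: "(\<Sum>w | ?f v \<rightarrow>\<^bsub>app_iso f G\<^esub> w. y w) = (\<Sum>w | v \<rightarrow>\<^bsub>G\<^esub> w. x w)" if v: "v \<in> verts G" for v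
  proof -
    have "{w. ?f v \<rightarrow>\<^bsub>app_iso f G\<^esub> w} = ?f ` {w. v \<rightarrow>\<^bsub>G\<^esub> w}"
    proof (intro equalityI subsetI)
      fix u assume "u \<in> {w. ?f v \<rightarrow>\<^bsub>app_iso f G\<^esub> w}"
      then obtain v' w where vw: "v' \<rightarrow>\<^bsub>G\<^esub> w" "?f v = ?f v'" "u = ?f w"
        unfolding arcs_ends_app_iso_eq[OF f] by auto
      then have "v = v'" using inj v by (blast dest: inj_onD adj_in_verts(1))
      with vw show "u \<in> ?f ` {w. v \<rightarrow>\<^bsub>G\<^esub> w}" by blast
    next
      fix u assume "u \<in> ?f ` {w. v \<rightarrow>\<^bsub>G\<^esub> w}"
      then show "u \<in> {w. ?f v \<rightarrow>\<^bsub>app_iso f G\<^esub> w}"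
        unfolding arcs_ends_app_iso_eq[OF f] by auto
    qed
    moreover have "inj_on ?f {w. v \<rightarrow>\<^bsub>G\<^esub> w}"
      by (rule inj_on_subset[OF inj]) (blast dest: adj_in_verts(2))
    moreover have "(\<Sum>w | v \<rightarrow>\<^bsub>G\<^esub> w. y (?f w)) = (\<Sum>w | v \<rightarrow>\<^bsub>G\<^esub> w. x w)"
      by (rule sum.cong[OF refl y]) (blast dest: adj_in_verts(2))
    ultimately show ?thesis
      by (simp add: sum.reindex o_def)
  qed
  show "l \<in> complementarity_spectrum (app_iso f G)"
    unfolding complementarity_spectrum_iff[OF H.fin_digraph]
    using nz x by (intro exI[of _ y]) (simp add: y S)
qed

lemma complementarity_spectrum_iso:
  assumes "fin_digraph G" and "digraph_iso G H"
  shows "complementarity_spectrum G = complementarity_spectrum H"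
proof -
  interpret fin_digraph G by fact
  obtain f where f: "digraph_isomorphism f" and H: "H = app_iso f G"
    using assms(2) unfolding digraph_iso_def by (elim exE conjE)
  have "complementarity_spectrum H \<subseteq> complementarity_spectrum (app_iso (inv_iso f) H)"
    unfolding H using f
    by (intro complementarity_spectrum_app_iso_subset fin_digraphI_app_iso digraph_isomorphism_invI)
  then show ?thesis
    using complementarity_spectrum_app_iso_subset[OF assms(1) f] app_iso_inv[OF f] H by simp
qed

section \<open>The eigenvalues of an infinity digraph above one\<close>

lemma out_neighbours_infinity_graph:
  assumes "2 \<le> r" and "2 \<le> s" and "v \<in> {1..r + s - 1}"
  shows "{w. (v, w) \<in> parcs (infinity_graph r s)} =
    (if v = 1 then {2, r + 1} else if v = r \<or> v = r + s - 1 then {1} else {v + 1})"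
proof -
  have "map_prod (glue r) (glue r) ` parcs (dicycle s) =
      insert (1, r + 1) (insert (r + s - 1, 1) {(k, k + 1) | k. r < k \<and> k < r + s - 1})"
    (is "?L = ?R")
  proof (intro equalityI subsetI)
    fix e assume "e \<in> ?L"
    then consider "e = (glue r s, glue r 1)"
      | k where "1 \<le> k" "k < s" "e = (glue r k, glue r (k + 1))"
      unfolding dicycle_def by auto
    then show "e \<in> ?R"
    proof cases
      case 1
      then show ?thesis using assms by (simp add: glue_def)
    next
      case 2
      then show ?thesis using assms by (cases "k = 1") (simp_all add: glue_def, linarith)
    qed
  next
    fix e assume "e \<in> ?R"
    then consider "e = (1, r + 1)" | "e = (r + s - 1, 1)"
      | k where "r < k" "k < r + s - 1" "e = (k, k + 1)" by blast
    then show "e \<in> ?L"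
    proof cases
      case 1
      then show ?thesis using assms
        by (intro image_eqI[of _ _ "(1, 2)"]) (auto simp: dicycle_def glue_def)
    next
      case 2
      then show ?thesis using assms
        by (intro image_eqI[of _ _ "(s, 1)"]) (auto simp: dicycle_def glue_def)
    next
      case 3
      then show ?thesis using assms
        by (intro image_eqI[of _ _ "(k + 1 - r, k + 1 - r + 1)"])
           (auto simp: dicycle_def glue_def)
    qed
  qed
  then have arcs: "parcs (infinity_graph r s) = parcs (dicycle r) \<union> ?R"
    by (simp only: infinity_graph_def pair_pre_digraph.simps)
  have mem: "(v, w) \<in> parcs (infinity_graph r s) \<longleftrightarrow>
      (1 \<le> v \<and> v < r \<and> w = v + 1 \<or> v = r \<and> w = 1) \<or>
      (v = 1 \<and> w = r + 1 \<or> v = r + s - 1 \<and> w = 1 \<or> r < v \<and> v < r + s - 1 \<and> w = v + 1)" for w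
    unfolding arcs dicycle_def by auto
  show ?thesis
    using assms by (simp add: set_eq_iff mem) presburger
qed

text \<open>The vertices \<open>a, \<dots>, b\<close> form a path whose last arc enters the vertex \<open>1\<close>; both cycles of
  \<open>\<infinity>(r,s)\<close> have this form once the arc leaving the centre is removed. Positivity propagates
  forward, so a positive entry makes all later inequalities tight.\<close>

lemma eigenvector_growth_along_path:
  fixes x :: "nat \<Rightarrow> real"
  assumes l: "0 < l"
    and step: "\<And>v. a \<le> v \<Longrightarrow> v \<le> b \<Longrightarrow>
      0 \<le> x v \<and> l * x v \<le> x (if v = b then 1 else v + 1) \<and>
      (0 < x v \<longrightarrow> x (if v = b then 1 else v + 1) = l * x v)"
    and v: "a \<le> v" "v \<le> b"
  shows "l ^ (b + 1 - v) * x v \<le> x 1 \<and> (0 < x v \<longrightarrow> l ^ (b + 1 - v) * x v = x 1)"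
  using v(2,1)
proof (induction v rule: inc_induct)
  case base
  then show ?case using step[of b] by simp
next
  case (step m)
  have m: "l * x m \<le> x (Suc m)" "0 < x m \<Longrightarrow> x (Suc m) = l * x m"
    using assms(2)[of m] step by auto
  have pw: "l ^ (b + 1 - m) = l ^ (b + 1 - Suc m) * l"
    using step by (simp add: Suc_diff_le flip: power_Suc2)
  have IH: "l ^ (b + 1 - Suc m) * x (Suc m) \<le> x 1"
    "0 < x (Suc m) \<Longrightarrow> l ^ (b + 1 - Suc m) * x (Suc m) = x 1"
    using step by auto
  have "l ^ (b + 1 - m) * x m \<le> l ^ (b + 1 - Suc m) * x (Suc m)"
    unfolding pw mult.assoc using m(1) l by (intro mult_left_mono) auto
  moreover have "l ^ (b + 1 - m) * x m = x 1" if "0 < x m"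
    using IH(2) m(2)[OF that] that l unfolding pw by (simp add: mult.assoc)
  ultimately show ?case using IH(1) by auto
qed

text \<open>The condition on the right is the characteristic equation
  \<open>l\<^sup>r\<^sup>+\<^sup>s\<^sup>-\<^sup>1 = l\<^sup>r\<^sup>-\<^sup>1 + l\<^sup>s\<^sup>-\<^sup>1\<close> of \<open>\<infinity>(r,s)\<close> in a form that depends on each cycle separately.\<close>

lemma complementarity_spectrum_infinity_graph:
  assumes r: "2 \<le> r" and s: "2 \<le> s" and l: "1 < l"
  shows "l \<in> complementarity_spectrum (with_proj (infinity_graph r s)) \<longleftrightarrow>
    inverse l ^ r + inverse l ^ s = 1"
proof -
  let ?n = "r + s - 1"
  interpret digraph "with_proj (infinity_graph r s)"
    using r s by (rule digraph_infinity_graph)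
  have S: "(\<Sum>w | (v, w) \<in> parcs (infinity_graph r s). x w) =
      (if v = 1 then x 2 + x (r + 1) else if v = r \<or> v = ?n then x 1 else x (v + 1))"
    if "v \<in> {1..?n}" for v and x :: "nat \<Rightarrow> real"
    using r by (simp add: out_neighbours_infinity_graph[OF r s that])
  define ev where "ev x v \<longleftrightarrow> (0 \<le> x v \<and>
      l * x v \<le> (if v = 1 then x 2 + x (r + 1) else if v = r \<or> v = ?n then x 1 else x (v + 1)) \<and>
      (0 < x v \<longrightarrow>
        (if v = 1 then x 2 + x (r + 1) else if v = r \<or> v = ?n then x 1 else x (v + 1)) = l * x v))"
    for x :: "nat \<Rightarrow> real" and v
  have ev_sum: "ev x v \<longleftrightarrow> (0 \<le> x v \<and>
      l * x v \<le> (\<Sum>w | (v, w) \<in> parcs (infinity_graph r s). x w) \<and>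
      (0 < x v \<longrightarrow> (\<Sum>w | (v, w) \<in> parcs (infinity_graph r s). x w) = l * x v))"
    if "v \<in> {1..?n}" for x v
    by (simp only: ev_def S[OF that])
  have iff: "l \<in> complementarity_spectrum (with_proj (infinity_graph r s)) \<longleftrightarrow>
      (\<exists>x. (\<exists>v\<in>{1..?n}. x v \<noteq> 0) \<and> (\<forall>v\<in>{1..?n}. ev x v))"
    unfolding complementarity_spectrum_iff[OF fin_digraph] with_proj_simps
      pverts_infinity_graph[OF r s]
    by (intro ex_cong1 conj_cong ball_cong refl ev_sum[symmetric])
  show ?thesis
  proof
    assume "l \<in> complementarity_spectrum (with_proj (infinity_graph r s))"
    then obtain x where nz: "\<exists>v\<in>{1..?n}. x v \<noteq> 0" and x: "\<And>v. v \<in> {1..?n} \<Longrightarrow> ev x v"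
      unfolding iff by blast
    have p1: "l ^ (r + 1 - v) * x v \<le> x 1 \<and> (0 < x v \<longrightarrow> l ^ (r + 1 - v) * x v = x 1)"
      if "2 \<le> v" "v \<le> r" for v
    proof (rule eigenvector_growth_along_path[OF _ _ that])
      fix u assume u: "2 \<le> u" "u \<le> r"
      then have "u \<in> {1..?n}" "u \<noteq> 1" "u \<noteq> ?n" using s by auto
      then show "0 \<le> x u \<and> l * x u \<le> x (if u = r then 1 else u + 1) \<and>
          (0 < x u \<longrightarrow> x (if u = r then 1 else u + 1) = l * x u)"
        using x[of u] by (cases "u = r") (simp_all add: ev_def del: One_nat_def)
    qed (use l in simp)
    have p2: "l ^ (?n + 1 - v) * x v \<le> x 1 \<and> (0 < x v \<longrightarrow> l ^ (?n + 1 - v) * x v = x 1)"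
      if "r + 1 \<le> v" "v \<le> ?n" for v
    proof (rule eigenvector_growth_along_path[OF _ _ that])
      fix u assume u: "r + 1 \<le> u" "u \<le> ?n"
      then have "u \<in> {1..?n}" "u \<noteq> 1" "u \<noteq> r" using r by auto
      then show "0 \<le> x u \<and> l * x u \<le> x (if u = ?n then 1 else u + 1) \<and>
          (0 < x u \<longrightarrow> x (if u = ?n then 1 else u + 1) = l * x u)"
        using x[of u] by (cases "u = ?n") (simp_all add: ev_def del: One_nat_def)
    qed (use l in simp)
    have nonneg: "0 \<le> x v" if "v \<in> {1..?n}" for v
      using x[OF that] by (simp add: ev_def)
    have one: "1 \<in> {1..?n}" using r by simp
    have "x 1 \<noteq> 0"
    proof
      assume x1: "x 1 = 0"
      have "x v = 0" if v: "v \<in> {1..?n}" for v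
      proof -
        have "v = 1 \<or> (2 \<le> v \<and> v \<le> r) \<or> (r + 1 \<le> v \<and> v \<le> ?n)" using v by auto
        then have "v = 1 \<or> (\<exists>k. l ^ k * x v \<le> 0)"
          using p1[of v] p2[of v] x1 by auto
        then show ?thesis
          using nonneg[OF v] x1 l by (auto simp: mult_le_0_iff not_le[THEN iffD2, OF zero_less_power])
      qed
      with nz show False by blast
    qed
    then have pos: "0 < x 1"
      using nonneg[OF one] by simp
    then have centre: "x 2 + x (r + 1) = l * x 1"
      using x[OF one] by (simp add: ev_def)
    \<comment> \<open>Here \<open>v\<close> stands for the centre's successor on the cycle of length \<open>k\<close>; the strict
      bound says that its entry cannot balance the equation at the centre alone.\<close>
    have succ: "x v = 0 \<or> x v = l * inverse l ^ k * x 1" "x v < l * x 1"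
      if "2 \<le> k" "0 \<le> x v"
        and slope: "l ^ (k - 1) * x v \<le> x 1 \<and> (0 < x v \<longrightarrow> l ^ (k - 1) * x v = x 1)" for v k
    proof -
      have lk: "l ^ k = l * l ^ (k - 1)" using \<open>2 \<le> k\<close> by (simp flip: power_Suc)
      show "x v = 0 \<or> x v = l * inverse l ^ k * x 1"
        using that(2) slope l pos by (cases "x v = 0") (simp_all add: less_le lk field_simps)
      have "1 * x v \<le> l ^ (k - 1) * x v"
        using l that(2) by (intro mult_right_mono) auto
      also have "\<dots> \<le> x 1" using slope ..
      also have "\<dots> < l * x 1" using l pos by simp
      finally show "x v < l * x 1" by simp
    qed
    have "x 2 = 0 \<or> x 2 = l * inverse l ^ r * x 1" "x 2 < l * x 1"
    proof -
      have eq: "r + 1 - 2 = r - 1" and nn: "0 \<le> x 2" using nonneg[of 2] r s by simp_all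
      show "x 2 = 0 \<or> x 2 = l * inverse l ^ r * x 1" "x 2 < l * x 1"
        by (rule succ[OF r nn p1[OF order_refl r, unfolded eq]])+
    qed
    moreover have "x (r + 1) = 0 \<or> x (r + 1) = l * inverse l ^ s * x 1" "x (r + 1) < l * x 1"
    proof -
      have eq: "?n + 1 - (r + 1) = s - 1" and nn: "0 \<le> x (r + 1)" and le: "r + 1 \<le> ?n"
        using nonneg[of "r + 1"] r s by simp_all
      show "x (r + 1) = 0 \<or> x (r + 1) = l * inverse l ^ s * x 1" "x (r + 1) < l * x 1"
        by (rule succ[OF s nn p2[OF order_refl le, unfolded eq]])+
    qed
    ultimately have "l * inverse l ^ r * x 1 + l * inverse l ^ s * x 1 = l * x 1"
      using centre by auto
    then have "(l * x 1) * (inverse l ^ r + inverse l ^ s) = (l * x 1) * 1"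
      by (simp add: algebra_simps)
    then show "inverse l ^ r + inverse l ^ s = 1"
      using l pos by (subst (asm) mult_cancel_left) auto
  next
    assume eq: "inverse l ^ r + inverse l ^ s = 1"
    \<comment> \<open>The exponent is the number of steps from \<open>v\<close> to the centre.\<close>
    define x where
      "x v = (if v = 1 then 1 else inverse l ^ (if v \<le> r then r + 1 - v else ?n + 1 - v))" for v
    have shift: "l * inverse l ^ Suc k = inverse l ^ k" for k
      using l by simp
    have centre: "x 2 + x (r + 1) = l * x 1"
    proof -
      have "x 2 = inverse l ^ (r - 1)" "x (r + 1) = inverse l ^ (s - 1)"
        using r s by (auto simp: x_def numeral_2_eq_2)
      then have "x 2 + x (r + 1) = l * inverse l ^ Suc (r - 1) + l * inverse l ^ Suc (s - 1)"
        by (simp only: shift)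
      also have "\<dots> = l * (inverse l ^ r + inverse l ^ s)"
        using r s by (simp add: distrib_left)
      finally show ?thesis using eq by (simp add: x_def)
    qed
    have "ev x v" if v: "v \<in> {1..?n}" for v
    proof -
      consider "v = 1" | "v = r \<or> v = ?n" "v \<noteq> 1" | "v \<noteq> 1" "v \<noteq> r" "v \<noteq> ?n" by blast
      then show ?thesis
      proof cases
        case 1
        then show ?thesis using centre l by (simp add: ev_def x_def)
      next
        case 2
        then have "x v = inverse l" using r s by (auto simp: x_def)
        then show ?thesis using 2 l by (simp add: ev_def x_def)
      next
        case 3
        have "(if v \<le> r then r + 1 - v else ?n + 1 - v) =
            Suc (if v + 1 \<le> r then r + 1 - (v + 1) else ?n + 1 - (v + 1))"
        proof (cases "v \<le> r")
          case True
          then have "v + 1 \<le> r" using 3 by linarith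
          then show ?thesis by simp
        next
          case False
          moreover have "v < ?n" using 3 v by simp
          ultimately show ?thesis by simp
        qed
        then have "x v = inverse l * x (v + 1)"
          using 3 v by (simp only: x_def power_Suc if_False) simp
        then have "l * x v = x (v + 1)" using l by simp
        moreover have "0 \<le> x v" using l by (simp add: x_def)
        ultimately show ?thesis using 3 by (simp add: ev_def)
      qed
    qed
    moreover have "x 1 \<noteq> 0" "1 \<in> {1..?n}" using r by (auto simp: x_def)
    ultimately show "l \<in> complementarity_spectrum (with_proj (infinity_graph r s))"
      unfolding iff by blast
  qed
qed

lemma exists_root_inverse_powers:
  assumes "2 \<le> r" and "2 \<le> s"
  shows "\<exists>l::real. 1 < l \<and> inverse l ^ r + inverse l ^ s = 1"
proof -
  have half: "(1/2) ^ k \<le> (1/2 :: real)" if "2 \<le> k" for k :: nat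
    using power_decreasing[of 1 k "1/2 :: real"] that by simp
  have "\<exists>q\<ge>1/2. q \<le> 1 \<and> q ^ r + q ^ s = (1::real)"
    using half[OF assms(1)] half[OF assms(2)]
    by (intro IVT') (auto intro!: continuous_intros)
  then obtain q :: real where q: "1/2 \<le> q" "q \<le> 1" "q ^ r + q ^ s = 1" by blast
  then have "q \<noteq> 1" by auto
  with q show ?thesis by (intro exI[of _ "inverse q"]) (auto simp: one_less_inverse_iff)
qed

section \<open>Recovering the cycle lengths\<close>

text \<open>Two numbers are determined up to order by their sum and their product: \<open>q ^ r\<close> is a root of
  \<open>(t - q ^ r') * (t - q ^ s') = t\<^sup>2 - t + q ^ (r + s)\<close>.\<close>

lemma exponents_determined:
  fixes q :: real
  assumes q: "0 < q" "q < 1"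
    and sums: "q ^ r + q ^ s = 1" "q ^ r' + q ^ s' = 1"
    and eq: "r + s = r' + s'"
  shows "r = r' \<and> s = s' \<or> r = s' \<and> s = r'"
proof -
  have prods: "q ^ r * q ^ s = q ^ r' * q ^ s'"
    by (simp add: eq flip: power_add)
  have "(q ^ r - q ^ r') * (q ^ r - q ^ s') =
      q ^ r * q ^ r - q ^ r * (q ^ r' + q ^ s') + q ^ r' * q ^ s'"
    by (simp add: algebra_simps)
  also have "\<dots> = q ^ r * (q ^ r + q ^ s - 1)"
    unfolding sums(2) prods[symmetric] by (simp add: algebra_simps)
  also have "\<dots> = 0" using sums(1) by simp
  finally have "q ^ r = q ^ r' \<or> q ^ r = q ^ s'" by simp
  moreover have "i = j" if "q ^ i = q ^ j" for i j
    using power_strict_decreasing[of i j q] power_strict_decreasing[of j i q] q that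
    by (cases i j rule: linorder_cases) auto
  ultimately have "r = r' \<or> r = s'" by blast
  then show ?thesis using eq by auto
qed

lemma infinity_graph_swap:
  assumes r: "2 \<le> r" and s: "2 \<le> s"
  shows "digraph_iso (with_proj (infinity_graph r s)) (with_proj (infinity_graph s r))"
proof -
  define f where "f k = (if k = 1 then 1 else if k \<le> r then s + k - 1 else k + 1 - r)" for k :: nat
  let ?hom = "\<lparr>iso_verts = f, iso_arcs = map_prod f f, iso_head = snd, iso_tail = fst\<rparr>"
  interpret digraph "with_proj (infinity_graph r s)"
    using r s by (rule digraph_infinity_graph)
  \<comment> \<open>So \<open>f\<close> carries the unshifted cycle of one digraph to the shifted cycle of the other, and
    vice versa.\<close>
  have glue: "k \<in> {1..r} \<Longrightarrow> f k = glue s k" "k \<in> {1..s} \<Longrightarrow> f (glue r k) = k" for k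
    using r s by (auto simp: f_def glue_def)
  have verts: "pverts (dicycle m) = {1..m}" for m
    by (simp add: dicycle_def)
  have arcs: "fst e \<in> {1..m} \<and> snd e \<in> {1..m}" if "2 \<le> m" "e \<in> parcs (dicycle m)" for m e
    using that by (auto simp: dicycle_def)
  have img_v: "f ` pverts (infinity_graph r s) = pverts (infinity_graph s r)"
  proof -
    have "f ` {1..r} = glue s ` {1..r}"
      using glue(1) by (rule image_cong[OF refl])
    moreover have "f ` glue r ` {1..s} = (\<lambda>k. k) ` {1..s}"
      unfolding image_image using glue(2) by (rule image_cong[OF refl])
    ultimately show ?thesis
      by (simp add: infinity_graph_def verts image_Un Un_commute del: One_nat_def)
  qed
  have img_a: "map_prod f f ` parcs (infinity_graph r s) = parcs (infinity_graph s r)"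
  proof -
    have "map_prod f f ` parcs (dicycle r) = map_prod (glue s) (glue s) ` parcs (dicycle r)"
      using arcs[OF r] glue(1) by (intro image_cong refl prod_eqI) simp_all
    moreover have "map_prod f f (map_prod (glue r) (glue r) e) = e" if "e \<in> parcs (dicycle s)" for e
      using arcs[OF s that] glue(2) by (intro prod_eqI) simp_all
    then have "map_prod f f ` map_prod (glue r) (glue r) ` parcs (dicycle s) = parcs (dicycle s)"
      by (simp add: image_image cong: image_cong)
    ultimately show ?thesis
      by (simp add: infinity_graph_def image_Un Un_commute)
  qed
  have inj: "inj_on f (pverts (infinity_graph r s))"
    unfolding pverts_infinity_graph[OF r s]
    using r s by (auto simp: inj_on_def f_def split: if_splits)
  have "inj_on (map_prod f f) (parcs (infinity_graph r s))"
  proof (rule inj_on_subset[OF map_prod_inj_on[OF inj inj]])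
    show "parcs (infinity_graph r s) \<subseteq> pverts (infinity_graph r s) \<times> pverts (infinity_graph r s)"
      using tail_in_verts head_in_verts by (simp add: subset_iff mem_Times_iff)
  qed
  then have "digraph_isomorphism ?hom"
    using inj wf_digraph by (simp add: digraph_isomorphism_def)
  moreover have "with_proj (infinity_graph s r) = app_iso ?hom (with_proj (infinity_graph r s))"
    by (simp add: app_iso_def img_v img_a with_proj_def)
  ultimately show ?thesis
    unfolding digraph_iso_def by blast
qed

theorem corollary3p3:
  shows "DCS (infinity_digraphs :: ('a, 'b) pre_digraph set)"
  unfolding DCS_def
proof (intro allI ballI impI)
  fix n and D H :: "('a, 'b) pre_digraph"
  assume "D \<in> infinity_digraphs"
  then obtain r s where D: "digraph D" and rs: "2 \<le> r" "2 \<le> s"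
    and isoD: "digraph_iso D (with_proj (infinity_graph r s))"
    unfolding infinity_digraphs_def by blast
  assume "H \<in> infinity_digraphs"
  then obtain r' s' where H: "digraph H" and rs': "2 \<le> r'" "2 \<le> s'"
    and isoH: "digraph_iso H (with_proj (infinity_graph r' s'))"
    unfolding infinity_digraphs_def by blast
  assume a: "card (verts D) = n \<and> card (verts H) = n \<and>
    complementarity_spectrum D = complementarity_spectrum H"
  note fin = digraph.axioms(1)
  have card: "card (verts G) = k + m - 1"
    if km: "digraph_iso G (with_proj (infinity_graph k m))" "2 \<le> k" "2 \<le> m"
    for G :: "('a, 'b) pre_digraph" and k m
  proof -
    obtain f where f: "pre_digraph.digraph_isomorphism G f"
      and eq: "with_proj (infinity_graph k m) = app_iso f G"
      using km(1) unfolding digraph_iso_def by blast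
    have "iso_verts f ` verts G = {1..k + m - 1}"
      using arg_cong[OF eq, of verts] pverts_infinity_graph[OF km(2,3)] by simp
    then show ?thesis using card_verts_iso[OF f] by simp
  qed
  have "r + s - 1 = r' + s' - 1"
    using a card[OF isoD rs] card[OF isoH rs'] by simp
  then have sum: "r + s = r' + s'" using rs rs' by linarith
  have spec: "complementarity_spectrum (with_proj (infinity_graph r s)) =
      complementarity_spectrum (with_proj (infinity_graph r' s'))"
    using a complementarity_spectrum_iso[OF fin[OF D] isoD]
      complementarity_spectrum_iso[OF fin[OF H] isoH]
    by simp
  obtain l :: real where l: "1 < l" "inverse l ^ r + inverse l ^ s = 1"
    using exists_root_inverse_powers[OF rs] by blast
  then have "inverse l ^ r' + inverse l ^ s' = 1"
    using spec by (simp flip: complementarity_spectrum_infinity_graph[OF rs l(1)]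
      complementarity_spectrum_infinity_graph[OF rs' l(1)])
  then have "r = r' \<and> s = s' \<or> r = s' \<and> s = r'"
    using l sum by (intro exponents_determined[of "inverse l"]) (auto simp: inverse_less_1_iff)
  then have "digraph_iso D (with_proj (infinity_graph r' s'))"
    using isoD digraph_iso_trans[OF isoD infinity_graph_swap[OF rs]] by (elim disjE conjE) simp_all
  moreover have "digraph_iso (with_proj (infinity_graph r' s')) H"
    by (rule digraph_iso_swap[OF fin_digraph.axioms(1)[OF fin[OF H]] isoH])
  ultimately show "digraph_iso D H"
    by (rule digraph_iso_trans)
qed

end
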